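(* Let $G$ be a group and let $\mathcal{N}(G)$ be the set of normal subgroups of $G$. For $H, K \in \mathcal{N}(G)$ define $H + K := H \sqcup K$ and $H\,K := [H,K]$, and set $0 := \{1\}$, the trivial subgroup. Then $\mathcal{N}(G)$, with these operations, is a non-unital, not necessarily associative, commutative semiring.
   Context: For subgroups $H, K$ of $G$, $H \sqcup K$ denotes the subgroup generated by $H$ and $K$, and $[H,K]$ denotes the subgroup generated by all commutators $[h,k] = h k h^{-1} k^{-1}$ with $h \in H$, $k \in K$. A non-unital, not necessarily associative, commutative semiring is a set $R$ with two binary operations $+$ and $\cdot$ and an element $0$ such that $(R,+,0)$ is a commutative monoid, multiplication is commutative, multiplication distributes over addition on both sides, and $0 \cdot x = x \cdot 0 = 0$ for all $x \in R$. No associativity of multiplication, no multiplicative identity and no additive inverses are required (this is Mathlib's NonUnitalNonAssocCommSemiring). The claim includes that the operations are well defined, i.e. that they take values in $\mathcal{N}(G)$. *)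

theory Defs
  imports "HOL-Algebra.Generated_Groups"
begin

text \<open>
  Carrier and operations are explicit parameters because the library's ring record always has a
  multiplicative unit as a field.
\<close>

locale nonunital_nonassoc_comm_semiring =
  fixes R :: "'a set"
    and plus :: "'a \<Rightarrow> 'a \<Rightarrow> 'a"
    and times :: "'a \<Rightarrow> 'a \<Rightarrow> 'a"
    and zero :: 'a
  assumes add_comm_monoid: "comm_monoid \<lparr>carrier = R, mult = plus, one = zero\<rparr>"
    and times_closed: "\<lbrakk>x \<in> R; y \<in> R\<rbrakk> \<Longrightarrow> times x y \<in> R"
    and times_comm: "\<lbrakk>x \<in> R; y \<in> R\<rbrakk> \<Longrightarrow> times x y = times y x"
    and distrib_left: "\<lbrakk>x \<in> R; y \<in> R; z \<in> R\<rbrakk> \<Longrightarrow> times x (plus y z) = plus (times x y) (times x z)"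
    and distrib_right: "\<lbrakk>x \<in> R; y \<in> R; z \<in> R\<rbrakk> \<Longrightarrow> times (plus x y) z = plus (times x z) (times y z)"
    and zero_times: "x \<in> R \<Longrightarrow> times zero x = zero"
    and times_zero: "x \<in> R \<Longrightarrow> times x zero = zero"

definition normal_subgroups :: "('a, 'b) monoid_scheme \<Rightarrow> 'a set set"
  where "normal_subgroups G = {N. N \<lhd> G}"

definition subgroup_join :: "('a, 'b) monoid_scheme \<Rightarrow> 'a set \<Rightarrow> 'a set \<Rightarrow> 'a set"
  where "subgroup_join G H K = generate G (H \<union> K)"

definition commutator_subgroup :: "('a, 'b) monoid_scheme \<Rightarrow> 'a set \<Rightarrow> 'a set \<Rightarrow> 'a set"
  where "commutator_subgroup G H K =
    generate G {h \<otimes>\<^bsub>G\<^esub> k \<otimes>\<^bsub>G\<^esub> inv\<^bsub>G\<^esub> h \<otimes>\<^bsub>G\<^esub> inv\<^bsub>G\<^esub> k | h k. h \<in> H \<and> k \<in> K}"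

lemma commutator_subgroup_self: "commutator_subgroup G H H = derived G H"
  unfolding commutator_subgroup_def derived_def by (rule arg_cong[of _ _ "generate G"]) auto

end

theory Submission
  imports Defs
begin

text \<open>
  Joins of normal subgroups form a commutative monoid because the subgroup generated by a union
  may be computed in stages, and joins and commutator subgroups stay normal because their
  generating sets are closed under conjugation.

  The substance is distributivity. Fix a set \<open>H\<close> of elements and a normal subgroup \<open>N\<close>. The elements
  whose commutators with all of \<open>H\<close> lie in \<open>N\<close> form a subgroup \<open>C\<close>: it is the preimage of the
  centralizer of the image of \<open>H\<close> in \<open>G/N\<close>. Hence \<open>[H,K] \<subseteq> N\<close> iff \<open>K \<subseteq> C\<close>, so \<open>K \<mapsto> [H,K]\<close>
  is a lower adjoint and as such preserves joins: for \<open>N = [H,K] \<squnion> [H,L]\<close> both \<open>K\<close> and \<open>L\<close> are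
  contained in \<open>C\<close> (lemma \<open>subgroup_centralizer_mod\<close>), hence so is \<open>K \<squnion> L\<close>, which means
  \<open>[H, K \<squnion> L] \<subseteq> N\<close>. The other inclusion is monotonicity. Distributivity on the other side follows
  by symmetry of the commutator subgroup, which holds because inverting a commutator swaps its
  arguments.
\<close>

context group
begin

abbreviation commutator :: "'a \<Rightarrow> 'a \<Rightarrow> 'a"
  where "commutator h k \<equiv> h \<otimes> k \<otimes> inv h \<otimes> inv k"

lemma inv_mult_cancel_left:
  assumes "x \<in> carrier G" "y \<in> carrier G"
  shows "inv x \<otimes> (x \<otimes> y) = y" "x \<otimes> (inv x \<otimes> y) = y"
  using assms by (simp_all flip: m_assoc)

section \<open>Commutator identities\<close>

lemma inv_commutator:
  assumes "h \<in> carrier G" "k \<in> carrier G"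
  shows "inv (commutator h k) = commutator k h"
  using assms by (simp add: inv_mult_group m_assoc)

lemma commutator_mult_right:
  assumes "h \<in> carrier G" "k \<in> carrier G" "l \<in> carrier G"
  shows "commutator h (k \<otimes> l) = commutator h k \<otimes> (k \<otimes> commutator h l \<otimes> inv k)"
  using assms by (simp add: inv_mult_group m_assoc inv_mult_cancel_left)

lemma commutator_inv_right:
  assumes "h \<in> carrier G" "k \<in> carrier G"
  shows "commutator h (inv k) = inv k \<otimes> inv (commutator h k) \<otimes> k"
  using assms by (simp add: inv_mult_group m_assoc inv_mult_cancel_left)

lemma conj_commutator:
  assumes "g \<in> carrier G" "h \<in> carrier G" "k \<in> carrier G"
  shows "g \<otimes> commutator h k \<otimes> inv g = commutator (g \<otimes> h \<otimes> inv g) (g \<otimes> k \<otimes> inv g)"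
  using assms by (simp add: inv_mult_group m_assoc inv_mult_cancel_left)

text \<open>
  This is the centralizer of \<open>H\<close> modulo \<open>N\<close>. It is closed under products and inverses because the
  commutator identities express \<open>[h, k l]\<close> and \<open>[h, k\<^sup>-\<^sup>1]\<close> through conjugates of \<open>[h,k]\<close>,
  \<open>[h,l]\<close> and their inverses, and normality of \<open>N\<close> absorbs the conjugations.
\<close>
lemma subgroup_centralizer_mod:
  assumes "N \<lhd> G" "H \<subseteq> carrier G"
  shows "subgroup {k \<in> carrier G. \<forall>h\<in>H. commutator h k \<in> N} G"
proof -
  interpret N: normal N G by fact
  have H: "h \<in> carrier G" if "h \<in> H" for h using assms(2) that by blast
  show ?thesis
  proof (rule subgroup.intro)
    fix k l
    assume k: "k \<in> {k \<in> carrier G. \<forall>h\<in>H. commutator h k \<in> N}"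
      and l: "l \<in> {k \<in> carrier G. \<forall>h\<in>H. commutator h k \<in> N}"
    have "commutator h (k \<otimes> l) \<in> N" if "h \<in> H" for h
      using k l that H[OF that] N.inv_op_closed2[of k "commutator h l"]
      by (subst commutator_mult_right) auto
    then show "k \<otimes> l \<in> {k \<in> carrier G. \<forall>h\<in>H. commutator h k \<in> N}"
      using k l by simp
  next
    fix k
    assume k: "k \<in> {k \<in> carrier G. \<forall>h\<in>H. commutator h k \<in> N}"
    have "commutator h (inv k) \<in> N" if "h \<in> H" for h
      using k that H[OF that] N.inv_op_closed1[of k "inv (commutator h k)"]
      by (subst commutator_inv_right) auto
    then show "inv k \<in> {k \<in> carrier G. \<forall>h\<in>H. commutator h k \<in> N}"
      using k by simp
  qed (auto simp: H)
qed

section \<open>Joins\<close>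

lemma subgroup_join_subset_iff:
  assumes "subgroup M G"
  shows "subgroup_join G H K \<subseteq> M \<longleftrightarrow> H \<subseteq> M \<and> K \<subseteq> M"
  using generate_subgroup_incl[OF _ assms, of "H \<union> K"] generate.incl[of _ "H \<union> K" G]
  unfolding subgroup_join_def by blast

lemma subset_subgroup_join:
  "H \<subseteq> subgroup_join G H K" "K \<subseteq> subgroup_join G H K"
  unfolding subgroup_join_def by (auto intro: generate.incl)

lemma subgroup_join_commute: "subgroup_join G H K = subgroup_join G K H"
  by (simp add: subgroup_join_def Un_commute)

lemma normal_subgroup_join:
  assumes "H \<lhd> G" "K \<lhd> G"
  shows "subgroup_join G H K \<lhd> G"
  unfolding subgroup_join_def
proof (rule normal_generateI)
  show "H \<union> K \<subseteq> carrier G"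
    using assms by (simp add: normal_imp_subgroup subgroup.subset)
qed (use assms in \<open>auto intro: normal.inv_op_closed2\<close>)

lemma subgroup_join_assoc:
  assumes "H \<lhd> G" "K \<lhd> G" "L \<lhd> G"
  shows "subgroup_join G (subgroup_join G H K) L = subgroup_join G H (subgroup_join G K L)"
  (is "?A = ?B")
proof
  have A: "subgroup ?A G" and B: "subgroup ?B G"
    using assms by (simp_all add: normal_imp_subgroup normal_subgroup_join)
  have "H \<subseteq> ?B" "K \<subseteq> ?B" "L \<subseteq> ?B"
    by (auto intro: subset_subgroup_join[THEN subsetD])
  then show "?A \<subseteq> ?B"
    using B by (simp add: subgroup_join_subset_iff)
  have "H \<subseteq> ?A" "K \<subseteq> ?A" "L \<subseteq> ?A"
    by (auto intro: subset_subgroup_join[THEN subsetD])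
  then show "?B \<subseteq> ?A"
    using A by (simp add: subgroup_join_subset_iff)
qed

lemma subgroup_join_one_left:
  assumes "subgroup H G"
  shows "subgroup_join G {\<one>} H = H"
  using subgroup_join_subset_iff[OF assms, of "{\<one>}" H] subset_subgroup_join(2)[of H "{\<one>}"]
    subgroup.one_closed[OF assms] by auto

section \<open>Commutator subgroups\<close>

lemma commutator_subgroup_subset_iff:
  assumes "subgroup M G"
  shows "commutator_subgroup G H K \<subseteq> M \<longleftrightarrow> (\<forall>h\<in>H. \<forall>k\<in>K. commutator h k \<in> M)"
    (is "_ \<longleftrightarrow> ?rhs")
proof
  assume le: "commutator_subgroup G H K \<subseteq> M"
  have "commutator h k \<in> commutator_subgroup G H K" if "h \<in> H" "k \<in> K" for h k
    unfolding commutator_subgroup_def by (rule generate.incl) (use that in blast)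
  then show ?rhs
    using le by blast
next
  assume rhs: ?rhs
  show "commutator_subgroup G H K \<subseteq> M"
    unfolding commutator_subgroup_def
    by (rule generate_subgroup_incl[OF _ assms]) (use rhs in auto)
qed

lemma normal_commutator_subgroup:
  assumes "H \<lhd> G" "K \<lhd> G"
  shows "commutator_subgroup G H K \<lhd> G"
proof -
  interpret H: normal H G by fact
  interpret K: normal K G by fact
  show ?thesis
    unfolding commutator_subgroup_def
  proof (rule normal_generateI)
    fix c g
    assume "c \<in> {commutator h k | h k. h \<in> H \<and> k \<in> K}" and g: "g \<in> carrier G"
    then obtain h k where hk: "h \<in> H" "k \<in> K" "c = commutator h k" by blast
    have "g \<otimes> c \<otimes> inv g = commutator (g \<otimes> h \<otimes> inv g) (g \<otimes> k \<otimes> inv g)"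
      unfolding hk(3) using g hk by (intro conj_commutator) auto
    then show "g \<otimes> c \<otimes> inv g \<in> {commutator h k | h k. h \<in> H \<and> k \<in> K}"
      using H.inv_op_closed2[OF g hk(1)] K.inv_op_closed2[OF g hk(2)]
      by blast
  qed auto
qed

lemma commutator_subgroup_commute_subset:
  assumes "H \<lhd> G" "K \<lhd> G"
  shows "commutator_subgroup G H K \<subseteq> commutator_subgroup G K H"
proof -
  have M: "subgroup (commutator_subgroup G K H) G"
    using assms by (intro normal_imp_subgroup normal_commutator_subgroup)
  have "commutator h k \<in> commutator_subgroup G K H" if "h \<in> H" "k \<in> K" for h k
  proof -
    have "commutator k h \<in> commutator_subgroup G K H"
      using commutator_subgroup_subset_iff[OF M] that by blast
    then have "inv (commutator k h) \<in> commutator_subgroup G K H"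
      by (rule subgroup.m_inv_closed[OF M])
    moreover have "h \<in> carrier G" "k \<in> carrier G"
      using that assms[THEN normal_imp_subgroup] by (auto dest: subgroup.mem_carrier)
    ultimately show ?thesis
      by (simp only: inv_commutator)
  qed
  then show ?thesis
    by (simp add: commutator_subgroup_subset_iff[OF M])
qed

lemma commutator_subgroup_commute:
  assumes "H \<lhd> G" "K \<lhd> G"
  shows "commutator_subgroup G H K = commutator_subgroup G K H"
  using assms by (intro equalityI commutator_subgroup_commute_subset)

lemma commutator_subgroup_mono_right:
  assumes "K \<subseteq> L"
  shows "commutator_subgroup G H K \<subseteq> commutator_subgroup G H L"
  unfolding commutator_subgroup_def using assms by (intro mono_generate) blast

lemma commutator_subgroup_one_right:
  assumes "H \<lhd> G"
  shows "commutator_subgroup G H {\<one>} = {\<one>}"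
proof -
  have "h \<in> carrier G" if "h \<in> H" for h
    using assms that by (rule subgroup.mem_carrier[OF normal_imp_subgroup])
  then have "commutator_subgroup G H {\<one>} \<subseteq> {\<one>}"
    by (simp add: commutator_subgroup_subset_iff[OF triv_subgroup])
  moreover have "\<one> \<in> commutator_subgroup G H {\<one>}"
    unfolding commutator_subgroup_def by (rule generate.one)
  ultimately show ?thesis by blast
qed

text \<open>
  Only the inclusion from left to right has content: the elements that commute with \<open>H\<close> modulo the
  right-hand side form a subgroup, so containing \<open>K\<close> and \<open>L\<close> it contains their join.
\<close>
lemma commutator_subgroup_join_right:
  assumes "H \<lhd> G" "K \<lhd> G" "L \<lhd> G"
  shows "commutator_subgroup G H (subgroup_join G K L) =
    subgroup_join G (commutator_subgroup G H K) (commutator_subgroup G H L)"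
    (is "?A = ?N")
proof
  have N: "?N \<lhd> G"
    using assms by (intro normal_subgroup_join normal_commutator_subgroup)
  note N_sub = normal_imp_subgroup[OF N]
  let ?C = "{k \<in> carrier G. \<forall>h\<in>H. commutator h k \<in> ?N}"
  have C: "subgroup ?C G"
    using assms by (intro subgroup_centralizer_mod[OF N] subgroup.subset normal_imp_subgroup)
  have carr: "K \<subseteq> carrier G" "L \<subseteq> carrier G"
    using assms by (simp_all add: normal_imp_subgroup subgroup.subset)
  have "\<forall>h\<in>H. \<forall>k\<in>K. commutator h k \<in> ?N" "\<forall>h\<in>H. \<forall>l\<in>L. commutator h l \<in> ?N"
    by (simp_all only: subset_subgroup_join flip: commutator_subgroup_subset_iff[OF N_sub])
  then have "K \<subseteq> ?C" "L \<subseteq> ?C"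
    using carr by blast+
  then have "subgroup_join G K L \<subseteq> ?C"
    by (simp only: subgroup_join_subset_iff[OF C])
  then have "\<forall>h\<in>H. \<forall>k\<in>subgroup_join G K L. commutator h k \<in> ?N"
    by blast
  then show "?A \<subseteq> ?N"
    by (simp only: commutator_subgroup_subset_iff[OF N_sub])
  have "subgroup ?A G"
    using assms by (intro normal_imp_subgroup normal_commutator_subgroup normal_subgroup_join)
  then show "?N \<subseteq> ?A"
    by (simp add: subgroup_join_subset_iff commutator_subgroup_mono_right subset_subgroup_join)
qed

end

section \<open>The semiring of normal subgroups\<close>

theorem mainTheorem2:
  fixes G :: "('a, 'b) monoid_scheme"
  assumes "group G"
  shows "nonunital_nonassoc_comm_semiring (normal_subgroups G)
    (subgroup_join G) (commutator_subgroup G) {\<one>\<^bsub>G\<^esub>}"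
proof -
  interpret group G by fact
  show ?thesis
  proof (rule nonunital_nonassoc_comm_semiring.intro, unfold normal_subgroups_def mem_Collect_eq)
    show "comm_monoid \<lparr>carrier = {N. N \<lhd> G}, mult = subgroup_join G, one = {\<one>\<^bsub>G\<^esub>}\<rparr>"
      by (rule comm_monoidI)
        (simp_all add: normal_subgroup_join one_is_normal subgroup_join_assoc
          subgroup_join_one_left normal_imp_subgroup, rule subgroup_join_commute)
  next
    fix x y assume "x \<lhd> G" "y \<lhd> G"
    then show "commutator_subgroup G x y \<lhd> G"
      by (rule normal_commutator_subgroup)
  next
    fix x y assume "x \<lhd> G" "y \<lhd> G"
    then show "commutator_subgroup G x y = commutator_subgroup G y x"
      by (rule commutator_subgroup_commute)
  next
    fix x y z assume "x \<lhd> G" "y \<lhd> G" "z \<lhd> G"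
    then show "commutator_subgroup G x (subgroup_join G y z) =
        subgroup_join G (commutator_subgroup G x y) (commutator_subgroup G x z)"
      by (rule commutator_subgroup_join_right)
  next
    fix x y z assume "x \<lhd> G" "y \<lhd> G" "z \<lhd> G"
    then show "commutator_subgroup G (subgroup_join G x y) z =
        subgroup_join G (commutator_subgroup G x z) (commutator_subgroup G y z)"
      by (simp add: commutator_subgroup_commute[of _ z] normal_subgroup_join
          commutator_subgroup_join_right)
  next
    fix x assume "x \<lhd> G"
    then show "commutator_subgroup G {\<one>\<^bsub>G\<^esub>} x = {\<one>\<^bsub>G\<^esub>}"
      by (simp add: commutator_subgroup_commute[of "{\<one>\<^bsub>G\<^esub>}"] one_is_normal
          commutator_subgroup_one_right)
  next
    fix x assume "x \<lhd> G"
    then show "commutator_subgroup G x {\<one>\<^bsub>G\<^esub>} = {\<one>\<^bsub>G\<^esub>}"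
      by (rule commutator_subgroup_one_right)
  qed
qed

end
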